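(* Let $\varphi_1=\tfrac12\varphi$, where $\varphi$ is a Jacob's ladder, and let $\tilde Z^2(t)=\frac{d\varphi_1(t)}{dt}$. There is a constant $T_0=T_0[\varphi_1]$ such that for every $T\ge T_0$, with $\mathring{T}=\varphi_1^{-1}(T)$ and $\mathring{(T+2)}=\varphi_1^{-1}(T+2)$, the functions $T_n(\varphi_1(t)-T-1)$, $t\in[\mathring{T},\mathring{(T+2)}]$, $n=0,1,2,\dots$, where $T_n$ is the $n$-th Chebyshev polynomial of the first kind, form an orthogonal system on $[\mathring{T},\mathring{(T+2)}]$ with weight function $\frac{\tilde Z^2(t)}{\sqrt{1-(\varphi_1(t)-T-1)^2}}$; that is, for all $m,n\in\{0,1,2,\dots\}$, $$\int_{\mathring{T}}^{\mathring{(T+2)}}T_m(\varphi_1(t)-T-1)\,T_n(\varphi_1(t)-T-1)\,\frac{\tilde Z^2(t)}{\sqrt{1-(\varphi_1(t)-T-1)^2}}\,dt=0\quad(m\neq n),$$ $$\int_{\mathring{T}}^{\mathring{(T+2)}}\left[T_n(\varphi_1(t)-T-1)\right]^2\frac{\tilde Z^2(t)}{\sqrt{1-(\varphi_1(t)-T-1)^2}}\,dt=\begin{cases}\frac{\pi}{2}, & n\ge1,\\ \pi, & n=0.\end{cases}$$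
   Context: Hardy's function: $Z(t)=e^{i\vartheta(t)}\zeta(\tfrac12+it)$ with $\vartheta(t)=-\tfrac t2\ln\pi+\operatorname{Im}\ln\Gamma(\tfrac14+i\tfrac t2)$, where $\zeta$ is the Riemann zeta-function; thus $Z$ is real-valued and $Z^2(t)=|\zeta(\tfrac12+it)|^2$. Jacob's ladder: fix an infinitely differentiable, increasing, unbounded function $\mu:[y_0,\infty)\to\mathbb{R}$ with $\mu(y)\ge 7y\ln y$. The Jacob's ladder $\varphi$ (associated with $\mu$) is the solution $X(T)=\varphi(T)$, defined for all sufficiently large $T$, of the nonlinear integral equation $$\int_0^{\mu[X(T)]}Z^2(t)e^{-\frac{2}{X(T)}t}\,dt=\int_0^T Z^2(t)\,dt .$$ Put $\varphi_1(t)=\tfrac12\varphi(t)$. For large $t$ the function $\varphi_1$ is continuously differentiable, strictly increasing and unbounded, so it has an inverse $\varphi_1^{-1}$ on a half-line; its derivative is denoted $\tilde Z^2(t)=\frac{d\varphi_1(t)}{dt}$. With $\Phi(y)=\int_0^{\mu(y)}Z^2(t)e^{-2t/y}\,dt$ one has $\tilde Z^2(t)=\frac{Z^2(t)}{2\Phi'(\varphi(t))}$. The Chebyshev polynomial of the first kind $T_n$ (not to be confused with the real number $T$) is given by $T_n(\cos\theta)=\cos n\theta$. *)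

theory Defs
  imports
    "HOL-Complex_Analysis.Complex_Analysis"
    "HOL-Computational_Algebra.Polynomial"
begin

text \<open>
  The Riemann zeta-function on the half-plane \<open>Re s > 0\<close>, as the analytic continuation of its
  Dirichlet series. By the identity theorem the values at all \<open>s \<noteq> 1\<close> with \<open>Re s > 0\<close> are
  determined by this; the other values are unspecified and never used.
\<close>

definition zeta :: "complex \<Rightarrow> complex" where
  "zeta = (SOME f. f holomorphic_on ({s. Re s > 0} - {1}) \<and>
             (\<forall>s. Re s > 1 \<longrightarrow> (\<lambda>n. 1 / of_nat (Suc n) powr s) sums f s))"

definition hardy_theta :: "real \<Rightarrow> real" where
  "hardy_theta t = - (t / 2) * ln pi + Im (ln_Gamma (Complex (1/4) (t/2)))"

text \<open>
  The product below is real by the functional equation of the zeta-function; \<open>Re\<close> only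
  changes its type.
\<close>

definition hardy_Z :: "real \<Rightarrow> real" where
  "hardy_Z t = Re (exp (\<i> * of_real (hardy_theta t)) * zeta (Complex (1/2) t))"

text \<open>
  Infinite differentiability on \<open>[a, \<infinity>)\<close>: \<open>D k\<close> is the \<open>k\<close>-th derivative, one-sided at \<open>a\<close>.
\<close>

definition smooth_on_halfline :: "real \<Rightarrow> (real \<Rightarrow> real) \<Rightarrow> bool" where
  "smooth_on_halfline a f \<longleftrightarrow>
     (\<exists>D :: nat \<Rightarrow> real \<Rightarrow> real. (\<forall>y\<ge>a. D 0 y = f y) \<and>
        (\<forall>k. \<forall>y\<ge>a. (D k has_real_derivative D (Suc k) y) (at y within {a..})))"

definition ladder_generator :: "real \<Rightarrow> (real \<Rightarrow> real) \<Rightarrow> bool" where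
  "ladder_generator y0 \<mu> \<longleftrightarrow>
     y0 > 0 \<and> smooth_on_halfline y0 \<mu> \<and> mono_on {y0..} \<mu> \<and> \<not> bdd_above (\<mu> ` {y0..}) \<and>
     (\<forall>y\<ge>y0. \<mu> y \<ge> 7 * y * ln y)"

text \<open>
  \<open>\<phi>\<close> solves the integral equation on \<open>[T1, \<infinity>)\<close>; its values below \<open>T1\<close> are irrelevant.
\<close>

definition jacobs_ladder :: "real \<Rightarrow> (real \<Rightarrow> real) \<Rightarrow> real \<Rightarrow> (real \<Rightarrow> real) \<Rightarrow> bool" where
  "jacobs_ladder y0 \<mu> T1 \<phi> \<longleftrightarrow>
     (\<forall>T\<ge>T1. \<phi> T \<ge> y0 \<and>
        integral {0..\<mu> (\<phi> T)} (\<lambda>t. (hardy_Z t)\<^sup>2 * exp (- (2 / \<phi> T) * t)) =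
        integral {0..T} (\<lambda>t. (hardy_Z t)\<^sup>2))"

text \<open>
  The bijection onto \<open>[f t0, \<infinity>)\<close> expresses that \<open>f\<close> is unbounded above.
\<close>

definition ladder_regular_from :: "real \<Rightarrow> (real \<Rightarrow> real) \<Rightarrow> bool" where
  "ladder_regular_from t0 f \<longleftrightarrow>
     (\<forall>t\<ge>t0. f differentiable (at t)) \<and> continuous_on {t0..} (deriv f) \<and>
     strict_mono_on {t0..} f \<and> bij_betw f {t0..} {f t0..}"

definition chebyshev_T :: "nat \<Rightarrow> real poly" where
  "chebyshev_T n = (THE p. \<forall>\<theta>. poly p (cos \<theta>) = cos (real n * \<theta>))"

lemma chebyshev_poly_exists:
  "\<exists>p q :: real poly. (\<forall>\<theta>. poly p (cos \<theta>) = cos (real n * \<theta>)) \<and>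
     (\<forall>\<theta>. poly q (cos \<theta>) * sin \<theta> = sin (real n * \<theta>))"
proof (induction n)
  case 0
  show ?case by (intro exI[of _ 1] exI[of _ 0]) simp
next
  case (Suc n)
  then obtain p q :: "real poly"
    where p: "\<And>\<theta>. poly p (cos \<theta>) = cos (real n * \<theta>)"
      and q: "\<And>\<theta>. poly q (cos \<theta>) * sin \<theta> = sin (real n * \<theta>)" by blast
  have *: "real (Suc n) * \<theta> = real n * \<theta> + \<theta>" for \<theta> by (simp add: algebra_simps)
  have s: "sin \<theta> * sin \<theta> = 1 - cos \<theta> * cos \<theta>" for \<theta> :: real
    using sin_squared_eq[of \<theta>] by (simp add: power2_eq_square)
  have "poly ([:0, 1:] * p - [:1, 0, -1:] * q) (cos \<theta>) = cos (real (Suc n) * \<theta>)" for \<theta>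
  proof -
    have "cos (real (Suc n) * \<theta>) = poly p (cos \<theta>) * cos \<theta> - poly q (cos \<theta>) * (sin \<theta> * sin \<theta>)"
      unfolding * cos_add p[symmetric] q[symmetric] by simp
    then show ?thesis unfolding s by (simp add: algebra_simps)
  qed
  moreover have "poly (p + [:0, 1:] * q) (cos \<theta>) * sin \<theta> = sin (real (Suc n) * \<theta>)" for \<theta>
    unfolding * sin_add p[symmetric] q[symmetric] by (simp add: algebra_simps)
  ultimately show ?case by blast
qed

lemma chebyshev_T_cos: "poly (chebyshev_T n) (cos \<theta>) = cos (real n * \<theta>)"
proof -
  have "\<exists>!p :: real poly. \<forall>\<theta>. poly p (cos \<theta>) = cos (real n * \<theta>)"
  proof (rule ex_ex1I)
    show "\<exists>p :: real poly. \<forall>\<theta>. poly p (cos \<theta>) = cos (real n * \<theta>)"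
      using chebyshev_poly_exists by blast
  next
    fix p q :: "real poly"
    assume p: "\<forall>\<theta>. poly p (cos \<theta>) = cos (real n * \<theta>)"
      and q: "\<forall>\<theta>. poly q (cos \<theta>) = cos (real n * \<theta>)"
    have "{-1..1} \<subseteq> {x. poly (p - q) x = 0}"
    proof
      fix x :: real assume "x \<in> {-1..1}"
      then have "cos (arccos x) = x" by simp
      with p q show "x \<in> {x. poly (p - q) x = 0}" by (metis (mono_tags) cancel_comm_monoid_add_class.diff_cancel mem_Collect_eq poly_diff)
    qed
    moreover have "infinite {-1..1::real}" by (simp add: infinite_Icc)
    ultimately have "p - q = 0" using poly_roots_finite finite_subset by blast
    then show "p = q" by simp
  qed
  from theI'[OF this] show ?thesis unfolding chebyshev_T_def by blast
qed

end

theory Submission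
  imports Defs
begin

text \<open>
  Substituting \<open>\<phi>1 t - T - 1 = cos \<theta>\<close> turns the integrals into those of
  \<open>cos (m * \<theta>) * cos (n * \<theta>)\<close> over \<open>[0, \<pi>]\<close>, so the substance is the regularity of the ladder.
  With \<open>\<Phi> y = \<integral>\<^sub>0\<^bsup>\<mu> y\<^esup> Z\<^sup>2 t * exp (- 2 * t / y) dt\<close> and \<open>F T = \<integral>\<^sub>0\<^sup>T Z\<^sup>2\<close> the ladder is
  \<open>\<phi> = \<Phi>\<inverse> \<circ> F\<close>. Since \<open>Z\<close> is real-analytic and \<open>Z 0 = \<zeta> (1/2) < 0\<close>, it vanishes on no interval;
  hence \<open>F\<close> is strictly increasing and \<open>\<Phi>' > 0\<close>. As \<open>\<Phi> y < F (\<mu> y)\<close>, every large \<open>y\<close> is a value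
  of \<open>\<phi>\<close>.
\<close>

subsection \<open>The zeta-function to the right of the imaginary axis\<close>

text \<open>Mean value bound: the derivative of \<open>z powr (-s)\<close> is
  \<open>- s * z powr (-s - 1)\<close>, whose modulus on the segment is largest at the left end
  \<open>a\<close>.\<close>

lemma norm_diff_powr_le:
  fixes s :: complex and a :: real
  assumes "a > 0" "Re s > 0" "z \<in> of_real ` {a..a+1}"
  shows "norm (of_real a powr (-s) - z powr (-s)) \<le> norm s * a powr (- Re s - 1)"
proof -
  let ?S = "complex_of_real ` {a..a+1}"
  have cv: "convex ?S"
    by (rule convex_linear_image) (auto intro: bounded_linear.linear bounded_linear_of_real)
  have "norm (of_real a powr (-s) - z powr (-s))
          \<le> norm s * a powr (- Re s - 1) * norm (of_real a - z)"
  proof (rule field_differentiable_bound[OF cv])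
    fix w assume w: "w \<in> ?S"
    then obtain x where x: "w = of_real x" "a \<le> x" by auto
    have nz: "w \<notin> \<real>\<^sub>\<le>\<^sub>0" using x assms by auto
    show "((\<lambda>w. w powr (-s)) has_field_derivative (-s) * w powr (-s - 1)) (at w within ?S)"
      using has_field_derivative_powr[OF nz, of "-s"] by (rule has_field_derivative_at_within)
    have "norm (w powr (-s - 1)) = x powr (- Re s - 1)"
      using x assms by (simp add: norm_powr_real_powr)
    also have "\<dots> \<le> a powr (- Re s - 1)"
      using x assms by (intro powr_mono2') auto
    finally show "norm ((-s) * w powr (-s - 1)) \<le> norm s * a powr (- Re s - 1)"
      by (simp add: norm_mult mult_left_mono)
  qed (use assms in auto)
  also have "\<dots> \<le> norm s * a powr (- Re s - 1) * 1"
  proof (rule mult_left_mono)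
    from assms(3) obtain x where "z = of_real x" "a \<le> x" "x \<le> a + 1" by auto
    then show "norm (of_real a - z) \<le> 1" by (simp flip: of_real_diff)
  qed simp
  finally show ?thesis by simp
qed

text \<open>The difference between \<open>(n + 1) powr -s\<close> and the integral of \<open>x powr -s\<close> over
  \<open>[n + 1, n + 2]\<close>.\<close>

definition zeta_term :: "nat \<Rightarrow> complex \<Rightarrow> complex" where
  "zeta_term n s = of_nat (Suc n) powr (-s) -
     (of_nat (Suc (Suc n)) powr (1 - s) - of_nat (Suc n) powr (1 - s)) / (1 - s)"

text \<open>The term is the increment over \<open>[a, a + 1]\<close>, with \<open>a = n + 1\<close>,
  of the primitive \<open>?u\<close> of \<open>a powr (-s) - z powr (-s)\<close>, and the preceding
  bound controls that derivative. The gain of one power of \<open>a\<close> makes the series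
  converge for \<open>Re s > 0\<close>.\<close>

lemma norm_zeta_term_le:
  assumes "Re s > 0" "s \<noteq> 1"
  shows "norm (zeta_term n s) \<le> norm s * real (Suc n) powr (- Re s - 1)"
proof -
  define a where "a = real (Suc n)"
  have a: "a > 0" by (simp add: a_def)
  let ?S = "complex_of_real ` {a..a+1}"
  have cv: "convex ?S"
    by (rule convex_linear_image) (auto intro: bounded_linear.linear bounded_linear_of_real)
  let ?u = "\<lambda>z. of_real a powr (-s) * z - z powr (1 - s) / (1 - s)"
  have "norm (?u (of_real (a + 1)) - ?u (of_real a))
          \<le> norm s * a powr (- Re s - 1) * norm (complex_of_real (a + 1) - of_real a)"
  proof (rule field_differentiable_bound[OF cv])
    fix w assume w: "w \<in> ?S"
    then obtain x where x: "w = of_real x" "a \<le> x" by auto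
    have nz: "w \<notin> \<real>\<^sub>\<le>\<^sub>0" using x a by auto
    show "(?u has_field_derivative (of_real a powr (-s) - w powr (-s))) (at w within ?S)"
      using nz assms(2) by (auto intro!: derivative_eq_intros)
    show "norm (of_real a powr (-s) - w powr (-s)) \<le> norm s * a powr (- Re s - 1)"
      using norm_diff_powr_le[OF a assms(1) w] .
  qed (auto simp del: of_real_add)
  moreover have "?u (of_real (a + 1)) - ?u (of_real a) = zeta_term n s"
  proof -
    have "complex_of_real a = of_nat (Suc n)" "complex_of_real (a + 1) = of_nat (Suc (Suc n))"
      by (simp_all add: a_def)
    then show ?thesis
      by (simp only: zeta_term_def) (simp add: diff_divide_distrib algebra_simps)
  qed
  ultimately show ?thesis by (simp add: a_def)
qed

lemma summable_Suc_powr: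
  fixes p :: real
  assumes "p < -1"
  shows "summable (\<lambda>n. real (Suc n) powr p)"
  using assms summable_Suc_iff[of "\<lambda>n. real n powr p"] by (simp add: summable_real_powr_iff)

text \<open>The first-order Euler-Maclaurin continuation: for \<open>Re s > 1\<close>,
  \<open>1 / (s - 1)\<close> is the integral of \<open>x powr (-s)\<close> over
  \<open>[1, \<infinity>)\<close>, which the terms subtract piece by piece.\<close>

definition zeta_cont :: "complex \<Rightarrow> complex" where
  "zeta_cont s = 1 / (s - 1) + (\<Sum>n. zeta_term n s)"

lemma holomorphic_zeta_cont: "zeta_cont holomorphic_on ({s. Re s > 0} - {1})"
proof -
  let ?S = "{s. Re s > 0} - {1::complex}"
  have op: "open ?S" by (intro open_Diff open_halfspace_Re_gt) auto
  have "(\<lambda>s. \<Sum>n. zeta_term n s) holomorphic_on ?S"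
  proof (rule holomorphic_uniform_sequence[OF op])
    show "(\<lambda>s. \<Sum>i<n. zeta_term i s) holomorphic_on ?S" for n
      unfolding zeta_term_def by (intro holomorphic_intros) auto
    fix z assume "z \<in> ?S"
    then obtain d where d: "d > 0" "cball z d \<subseteq> ?S" using op open_contains_cball by blast
    \<comment> \<open>The least real part on the compact ball is attained inside the half-plane,
      hence positive; it gives one summable majorant for the whole ball.\<close>
    have "\<exists>m\<in>cball z d. \<forall>w\<in>cball z d. Re m \<le> Re w"
      using d(1) by (intro continuous_attains_inf continuous_on_Re continuous_on_id) auto
    then obtain m where m: "m \<in> cball z d" "\<And>w. w \<in> cball z d \<Longrightarrow> Re m \<le> Re w"
      by blast
    have "Re m > 0" using m d by auto
    have "uniform_limit (cball z d) (\<lambda>n s. \<Sum>i<n. zeta_term i s) (\<lambda>s. \<Sum>n. zeta_term n s) sequentially"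
    proof (rule Weierstrass_m_test)
      show "norm (zeta_term n s) \<le> (norm z + d) * real (Suc n) powr (- Re m - 1)"
        if s: "s \<in> cball z d" for n s
      proof -
        have "s \<in> ?S" using s d by blast
        then have "norm (zeta_term n s) \<le> norm s * real (Suc n) powr (- Re s - 1)"
          by (intro norm_zeta_term_le) auto
        also have "\<dots> \<le> (norm z + d) * real (Suc n) powr (- Re m - 1)"
        proof (rule mult_mono)
          have "norm (z - s) \<le> d" using s by (simp add: dist_norm)
          then show "norm s \<le> norm z + d"
            using norm_triangle_ineq4[of z "z - s"] by simp
          show "real (Suc n) powr (- Re s - 1) \<le> real (Suc n) powr (- Re m - 1)"
            using m(2)[OF s] by (intro powr_mono) auto
        qed (use d in auto)
        finally show ?thesis .
      qed
      show "summable (\<lambda>n. (norm z + d) * real (Suc n) powr (- Re m - 1))"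
        using \<open>Re m > 0\<close> by (intro summable_mult summable_Suc_powr) auto
    qed
    with d show "\<exists>d>0. cball z d \<subseteq> ?S \<and>
        uniform_limit (cball z d) (\<lambda>n s. \<Sum>i<n. zeta_term i s) (\<lambda>s. \<Sum>n. zeta_term n s) sequentially"
      by blast
  qed
  then show ?thesis
    unfolding zeta_cont_def by (intro holomorphic_intros) auto
qed

text \<open>For \<open>Re s > 1\<close> the subtracted increments telescope to
  \<open>1 / (s - 1)\<close>, so adding them back leaves the Dirichlet series.\<close>

lemma sums_zeta_cont:
  assumes "Re s > 1"
  shows "(\<lambda>n. 1 / of_nat (Suc n) powr s) sums zeta_cont s"
proof -
  have s1: "s \<noteq> 1" using assms by auto
  have "(\<lambda>n. zeta_term n s) sums (\<Sum>n. zeta_term n s)"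
  proof (rule summable_sums, rule summable_comparison_test')
    show "summable (\<lambda>n. norm s * real (Suc n) powr (- Re s - 1))"
      using assms by (intro summable_mult summable_Suc_powr) auto
    show "norm (zeta_term n s) \<le> norm s * real (Suc n) powr (- Re s - 1)" if "n \<ge> 0" for n
      using assms s1 by (intro norm_zeta_term_le) auto
  qed
  moreover have "(\<lambda>n. (of_nat (Suc (Suc n)) powr (1 - s) - of_nat (Suc n) powr (1 - s)) / (1 - s))
      sums ((0 - of_nat (Suc 0) powr (1 - s)) / (1 - s))"
  proof (intro sums_divide telescope_sums)
    have "(\<lambda>n. of_nat n powr (1 - s)) \<longlonglongrightarrow> 0"
      using tendsto_neg_powr_complex_of_nat[OF filterlim_ident, of "1 - s"] assms by simp
    then show "(\<lambda>n. of_nat (Suc n) powr (1 - s)) \<longlonglongrightarrow> 0"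
      by (rule LIMSEQ_Suc)
  qed
  ultimately have "(\<lambda>n. zeta_term n s + (of_nat (Suc (Suc n)) powr (1 - s) - of_nat (Suc n) powr (1 - s)) / (1 - s))
     sums ((\<Sum>n. zeta_term n s) + (0 - of_nat (Suc 0) powr (1 - s)) / (1 - s))"
    by (rule sums_add)
  moreover have "(\<Sum>n. zeta_term n s) + (0 - of_nat (Suc 0) powr (1 - s)) / (1 - s) = zeta_cont s"
    using s1 by (simp add: zeta_cont_def field_simps)
  moreover have "zeta_term n s + (of_nat (Suc (Suc n)) powr (1 - s) - of_nat (Suc n) powr (1 - s)) / (1 - s)
      = 1 / of_nat (Suc n) powr s" for n
    by (simp add: zeta_term_def powr_minus_divide del: of_nat_Suc)
  ultimately show ?thesis by simp
qed

text \<open>\<open>zeta_cont\<close> witnesses the choice made in \<open>zeta\<close>.\<close>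

lemma zeta_properties:
  "zeta holomorphic_on ({s. Re s > 0} - {1}) \<and>
     (\<forall>s. Re s > 1 \<longrightarrow> (\<lambda>n. 1 / of_nat (Suc n) powr s) sums zeta s)"
proof -
  have "\<exists>f. f holomorphic_on ({s. Re s > 0} - {1}) \<and>
      (\<forall>s. Re s > 1 \<longrightarrow> (\<lambda>n. 1 / of_nat (Suc n) powr s) sums f s)"
    using holomorphic_zeta_cont sums_zeta_cont by blast
  from someI_ex[OF this] show ?thesis unfolding zeta_def .
qed

lemmas holomorphic_zeta = zeta_properties[THEN conjunct1]

lemma zeta_eq_zeta_cont:
  assumes "Re s > 0" "s \<noteq> 1"
  shows "zeta s = zeta_cont s"
proof (rule analytic_continuation_open[where f = zeta and g = zeta_cont])
  show "open {s. Re s > 1}" by (rule open_halfspace_Re_gt)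
  show "open ({s. Re s > 0} - {1})" by (intro open_Diff open_halfspace_Re_gt) auto
  have "2 \<in> {s. Re s > 1}" by simp
  then show "{s. Re s > 1} \<noteq> {}" by blast
  show "connected ({s. Re s > 0} - {1})"
    by (intro connected_open_delete open_halfspace_Re_gt convex_connected convex_halfspace_Re_gt) simp
  show "zeta z = zeta_cont z" if "z \<in> {s. Re s > 1}" for z
    using that zeta_properties sums_zeta_cont[of z] sums_unique2 by blast
qed (use assms holomorphic_zeta holomorphic_zeta_cont in auto)

text \<open>At \<open>1/2\<close> the term \<open>1 / (s - 1)\<close> equals \<open>-2\<close>,
  while the series of \<open>zeta_term\<close> is at most a telescoping sum of value 1.\<close>

lemma Re_zeta_half_neg: "Re (zeta (1/2)) < 0"
proof -
  let ?t = "\<lambda>n. real (Suc n) powr (-1/2) - 2 * (real (Suc (Suc n)) powr (1/2) - real (Suc n) powr (1/2))"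
  have term_eq: "zeta_term n (1/2) = of_real (?t n)" for n
  proof -
    have "complex_of_nat (Suc n) powr (- (1/2)) = of_real (real (Suc n) powr (-1/2))"
         "complex_of_nat (Suc n) powr (1/2) = of_real (real (Suc n) powr (1/2))"
         "complex_of_nat (Suc (Suc n)) powr (1/2) = of_real (real (Suc (Suc n)) powr (1/2))"
      using powr_of_real[of "real (Suc n)" "-1/2"] powr_of_real[of "real (Suc n)" "1/2"]
        powr_of_real[of "real (Suc (Suc n))" "1/2"] by (simp_all del: of_nat_Suc)
    then show ?thesis by (simp add: zeta_term_def del: of_nat_Suc)
  qed
  \<comment> \<open>Since \<open>b\<^sup>2 - a\<^sup>2 = 1\<close>, one has
    \<open>2 * (b - a) = 2 / (a + b) \<ge> 1 / b\<close>.\<close>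
  have le: "?t n \<le> 1 / sqrt (real (Suc n)) - 1 / sqrt (real (Suc (Suc n)))" for n
  proof -
    define a b where "a = sqrt (real (Suc n))" and "b = sqrt (real (Suc (Suc n)))"
    have ab: "a > 0" "b > 0" "a \<le> b" by (auto simp: a_def b_def)
    have "b\<^sup>2 - a\<^sup>2 = 1" by (simp add: a_def b_def)
    then have "(b - a) * (a + b) = 1" by (simp add: power2_eq_square algebra_simps)
    then have "1 / b = (b - a) * (a + b) / b" by simp
    also have "\<dots> \<le> (b - a) * (2 * b) / b"
      using ab by (intro divide_right_mono mult_left_mono) auto
    finally have *: "1 / b \<le> 2 * (b - a)" using ab by simp
    have "?t n = 1 / a - 2 * (b - a)"
      by (simp add: a_def b_def powr_half_sqrt powr_minus_divide del: of_nat_Suc)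
    with * show ?thesis by (simp add: a_def b_def)
  qed
  have "(\<lambda>n. zeta_term n (1/2)) sums (\<Sum>n. zeta_term n (1/2))"
  proof (rule summable_sums, rule summable_comparison_test')
    show "summable (\<lambda>n. norm (1/2::complex) * real (Suc n) powr (- Re (1/2) - 1))"
      by (intro summable_mult summable_Suc_powr) auto
    show "norm (zeta_term n (1/2)) \<le> norm (1/2::complex) * real (Suc n) powr (- Re (1/2) - 1)"
      if "n \<ge> 0" for n
      by (intro norm_zeta_term_le) (auto simp: complex_eq_iff)
  qed
  from sums_Re[OF this] have 1: "?t sums Re (\<Sum>n. zeta_term n (1/2))"
    unfolding term_eq by (simp del: of_nat_Suc)
  have "(\<lambda>n. 1 / sqrt (real (Suc n)) - 1 / sqrt (real (Suc (Suc n)))) sums (1 / sqrt (real (Suc 0)) - 0)"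
  proof (rule telescope_sums')
    have "(\<lambda>n. 1 / sqrt (real n)) \<longlonglongrightarrow> 0"
      by (intro tendsto_divide_0[OF tendsto_const] filterlim_at_top_imp_at_infinity
           filterlim_compose[OF sqrt_at_top] filterlim_real_sequentially)
    then show "(\<lambda>n. 1 / sqrt (real (Suc n))) \<longlonglongrightarrow> 0"
      by (rule LIMSEQ_Suc)
  qed
  from sums_le[OF le 1 this] have "Re (\<Sum>n. zeta_term n (1/2)) \<le> 1" by simp
  moreover have "zeta (1/2) = zeta_cont (1/2)" by (rule zeta_eq_zeta_cont) (auto simp: complex_eq_iff)
  ultimately show ?thesis by (simp add: zeta_cont_def)
qed

subsection \<open>Hardy's function is real-analytic\<close>

text \<open>Schwarz reflection, as the strip is symmetric about the real axis. Combining a function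
  with its reflection extends its real or imaginary part on the real line holomorphically.\<close>

lemma holomorphic_on_cnj_strip:
  assumes "f holomorphic_on {z. \<bar>Im z\<bar> < r}"
  shows "(\<lambda>z. cnj (f (cnj z))) holomorphic_on {z. \<bar>Im z\<bar> < r}"
proof -
  have "open {z. \<bar>Im z\<bar> < r}"
    by (intro open_Collect_less continuous_intros)
  moreover have "cnj ` {z. \<bar>Im z\<bar> < r} = {z. \<bar>Im z\<bar> < r}"
    by (auto simp: in_image_cnj_iff)
  ultimately show ?thesis
    using holomorphic_on_compose_cnj_cnj[of f "{z. \<bar>Im z\<bar> < r}"] assms by (simp add: o_def)
qed

text \<open>The functional equation is not available to remove the \<open>Re\<close> in the definition of
  \<open>hardy_Z\<close>; averaging with the reflected function extends the real part holomorphically.\<close>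

lemma hardy_Z_extension:
  obtains G where "G holomorphic_on {z. \<bar>Im z\<bar> < 1/2}" "\<And>t. G (of_real t) = of_real (hardy_Z t)"
proof -
  \<comment> \<open>The width is dictated by \<open>Re (1/4 + \<i> * z / 2) > 0\<close> and
    \<open>Re (1/2 + \<i> * z) > 0\<close>, both equivalent to \<open>Im z < 1/2\<close>; the pole
    of zeta corresponds to \<open>z = - \<i> / 2\<close>, on the boundary.\<close>
  let ?A = "{z. \<bar>Im z\<bar> < 1/2}"
  define L where "L z = ln_Gamma (1/4 + \<i> * z / 2)" for z
  \<comment> \<open>On the real line the reflected difference is \<open>Im (L z)\<close>, so
    \<open>g\<close> extends \<open>hardy_theta\<close>.\<close>
  define g where "g z = - (z / 2) * of_real (ln pi) + (L z - cnj (L (cnj z))) / (2 * \<i>)" for z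
  define h where "h z = exp (\<i> * g z) * zeta (1/2 + \<i> * z)" for z
  define G where "G z = (h z + cnj (h (cnj z))) / 2" for z
  have L: "L holomorphic_on ?A"
  proof -
    have "ln_Gamma \<circ> (\<lambda>z. 1/4 + \<i> * z / 2) holomorphic_on ?A"
    proof (rule holomorphic_on_compose)
      show "(\<lambda>z. 1/4 + \<i> * z / 2) holomorphic_on ?A" by (intro holomorphic_intros) auto
      show "ln_Gamma holomorphic_on (\<lambda>z. 1/4 + \<i> * z / 2) ` ?A"
        by (rule holomorphic_ln_Gamma) (auto simp: complex_nonpos_Reals_iff)
    qed
    then show ?thesis by (simp add: o_def L_def[abs_def])
  qed
  have g: "g holomorphic_on ?A"
    unfolding g_def by (intro holomorphic_intros L holomorphic_on_cnj_strip) auto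
  have z: "(\<lambda>z. zeta (1/2 + \<i> * z)) holomorphic_on ?A"
  proof -
    have "zeta \<circ> (\<lambda>z. 1/2 + \<i> * z) holomorphic_on ?A"
      by (rule holomorphic_on_compose, intro holomorphic_intros,
          rule holomorphic_on_subset[OF holomorphic_zeta]) (auto simp: complex_eq_iff)
    then show ?thesis by (simp add: o_def)
  qed
  have h: "h holomorphic_on ?A"
    unfolding h_def by (intro holomorphic_intros g z)
  have "G holomorphic_on ?A"
    unfolding G_def by (intro holomorphic_intros h holomorphic_on_cnj_strip) auto
  moreover have "G (of_real t) = of_real (hardy_Z t)" for t
  proof -
    have re: "(z + cnj z) / 2 = of_real (Re z)" and im: "(z - cnj z) / (2 * \<i>) = of_real (Im z)" for z
      by (auto simp: complex_eq_iff)
    have "1/4 + \<i> * of_real t / 2 = Complex (1/4) (t/2)" "1/2 + \<i> * of_real t = Complex (1/2) t"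
      by (auto simp: complex_eq_iff)
    moreover have "g (of_real t) = of_real (- (t / 2) * ln pi + Im (L (of_real t)))"
      unfolding g_def complex_cnj_complex_of_real im by simp
    ultimately have "h (of_real t) = exp (\<i> * of_real (hardy_theta t)) * zeta (Complex (1/2) t)"
      by (simp only: h_def L_def hardy_theta_def)
    then show ?thesis
      unfolding G_def complex_cnj_complex_of_real re hardy_Z_def by simp
  qed
  ultimately show ?thesis by (rule that)
qed

lemma continuous_on_hardy_Z: "continuous_on A hardy_Z"
proof -
  obtain G where G: "G holomorphic_on {z. \<bar>Im z\<bar> < 1/2}" "\<And>t. G (of_real t) = of_real (hardy_Z t)"
    using hardy_Z_extension by blast
  have "continuous_on A (\<lambda>t. Re (G (of_real t)))"
    by (intro continuous_intros continuous_on_compose2[OF holomorphic_on_imp_continuous_on[OF G(1)]])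
       auto
  then show ?thesis by (simp add: G(2))
qed

text \<open>\<open>ln_Gamma\<close> is real at \<open>1/4\<close>, so the phase vanishes at 0 and
  only the zeta value remains.\<close>

lemma hardy_Z_0: "hardy_Z 0 < 0"
proof -
  have eq: "Complex (1/4) 0 = of_real (1/4)" "Complex (1/2) 0 = 1/2"
    by (auto simp: complex_eq_iff)
  have "hardy_theta 0 = 0"
    by (simp only: hardy_theta_def div_0 eq(1) ln_Gamma_complex_of_real) simp
  then show ?thesis using Re_zeta_half_neg by (simp add: hardy_Z_def flip: eq(2))
qed

text \<open>Zeros filling an interval accumulate, so by the identity theorem the extension would
  vanish on the connected strip, in particular at 0.\<close>

lemma hardy_Z_nonzero_on_interval:
  assumes "a < b"
  obtains t where "a \<le> t" "t \<le> b" "hardy_Z t \<noteq> 0"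
proof (rule ccontr)
  assume "\<not> thesis"
  with that have *: "hardy_Z t = 0" if "t \<in> {a..b}" for t using \<open>t \<in> {a..b}\<close> by force
  obtain G where G: "G holomorphic_on {z. \<bar>Im z\<bar> < 1/2}" "\<And>t. G (of_real t) = of_real (hardy_Z t)"
    using hardy_Z_extension by blast
  have "complex_of_real a islimpt closed_segment (of_real a) (of_real b)"
    using assms connected_imp_perfect[OF connected_segment(1)[of "complex_of_real a" "of_real b"]]
    by (metis closed_segment_eq_sing ends_in_segment(1) less_irrefl of_real_eq_iff singleton_iff)
  then have "complex_of_real a islimpt complex_of_real ` {a..b}"
    using assms by (simp add: closed_segment_of_real closed_segment_eq_real_ivl)
  moreover have "open {z. \<bar>Im z\<bar> < 1/2}" 
    by (intro open_Collect_less continuous_intros)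
  moreover have "connected {z. \<bar>Im z\<bar> < 1/2}"
  proof -
    have "{z. \<bar>Im z\<bar> < 1/2} = {z. Im z < 1/2} \<inter> {z. Im z > - (1/2)}" by auto
    then show ?thesis
      using convex_Int[OF convex_halfspace_Im_lt convex_halfspace_Im_gt, THEN convex_connected]
      by metis
  qed
  ultimately have "G 0 = 0"
    using G * by (intro analytic_continuation[of G "{z. \<bar>Im z\<bar> < 1/2}" "of_real ` {a..b}" "of_real a" 0]) auto
  then show False using hardy_Z_0 G(2)[of 0] by simp
qed

subsection \<open>Parameter integrals and Chebyshev orthogonality\<close>

text \<open>The parameter enters through both kernel and upper limit. The two are separated as
  \<open>?H y x\<close>, differentiated by Leibniz's rule and the fundamental theorem, and
  recombined by the chain rule along \<open>(y, m y)\<close>. The general \<open>W\<close> permits a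
  second use, with an extra factor \<open>t\<close>.\<close>

lemma has_real_derivative_exp_integral_diagonal:
  fixes W m :: "real \<Rightarrow> real"
  assumes W: "continuous_on UNIV W" and y: "y > 0" and my: "m y > 0"
    and m: "(m has_real_derivative m') (at y)"
  shows "((\<lambda>y. integral {0..m y} (\<lambda>t. W t * exp (- (2 / y) * t))) has_real_derivative
      (2 / y\<^sup>2) * integral {0..m y} (\<lambda>t. t * W t * exp (- (2 / y) * t)) +
      W (m y) * exp (- (2 / y) * m y) * m') (at y)"
proof -
  let ?k = "\<lambda>y t. W t * exp (- (2 / y) * t)"
  let ?H = "\<lambda>y x. integral {0..x} (?k y)"
  let ?X = "{0<..}" and ?Y = "{0<..}"
  note W' [continuous_intros] = continuous_on_compose2[OF W _ subset_UNIV]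
  let ?D = "integral {0..m y} (\<lambda>t. 2 / y\<^sup>2 * (t * W t * exp (- (2 / y) * t)))"
  have "((\<lambda>y'. integral (cbox 0 (m y)) (?k y')) has_real_derivative
          integral (cbox 0 (m y)) (\<lambda>t. 2 / y\<^sup>2 * (t * W t * exp (- (2 / y) * t)))) (at y within ?X)"
  proof (rule leibniz_rule_field_derivative)
    fix x t :: real assume x: "x \<in> ?X"
    show "((\<lambda>x. ?k x t) has_real_derivative 2 / x\<^sup>2 * (t * W t * exp (- (2 / x) * t))) (at x within ?X)"
      using x by (auto intro!: derivative_eq_intros simp: power2_eq_square)
    show "?k x integrable_on cbox 0 (m y)"
      by (intro integrable_continuous continuous_intros)
  next
    show "continuous_on (?X \<times> cbox 0 (m y)) (\<lambda>(x, t). 2 / x\<^sup>2 * (t * W t * exp (- (2 / x) * t)))"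
      unfolding split_beta by (intro continuous_intros) auto
  qed (use y in auto)
  then have 1: "((\<lambda>y'. ?H y' (m y)) has_derivative (\<lambda>h. ?D * h)) (at y within ?X)"
    by (simp only: has_field_derivative_def cbox_interval)
  have 2: "((\<lambda>x. ?H y' x) has_derivative blinfun_apply (blinfun_mult_right (?k y' x))) (at x within ?Y)"
    if "x \<in> ?Y" for x y'
  proof -
    have "((\<lambda>x. ?H y' x) has_real_derivative ?k y' x) (at x within {0..x+1})"
      using that by (intro integral_has_real_derivative continuous_intros) auto
    then have "((\<lambda>x. ?H y' x) has_real_derivative ?k y' x) (at x)"
      using that at_within_Icc_at[of 0 x "x+1"] by simp
    then show ?thesis
      by (simp add: has_field_derivative_def has_derivative_at_withinI)
  qed
  \<comment> \<open>Joint continuity of the partial derivative in \<open>x\<close>, together with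
    the partial derivative in \<open>y\<close> at the point itself, yields the total
    derivative.\<close>
  have "((\<lambda>(y, x). ?H y x) has_derivative (\<lambda>(tx, ty). ?D * tx + blinfun_mult_right (?k y (m y)) ty))
      (at (y, m y) within ?X \<times> ?Y)"
  proof (rule has_derivative_partialsI[OF 1 2])
    have "continuous_on (?X \<times> ?Y) (\<lambda>(y, x). blinfun_mult_right (?k y x))"
      unfolding split_beta by (intro continuous_intros) auto
    then show "continuous (at (y, m y) within ?X \<times> ?Y) (\<lambda>(y, x). blinfun_mult_right (?k y x))"
      using y my by (simp add: continuous_on_eq_continuous_within)
  qed (use my in auto)
  moreover have "at (y, m y) within ?X \<times> ?Y = at (y, m y)"
    using y my by (intro at_within_open open_Times) auto
  ultimately have H: "((\<lambda>(y, x). ?H y x) has_derivative (\<lambda>(tx, ty). ?D * tx + ?k y (m y) * ty)) (at (y, m y))"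
    by simp
  have "((\<lambda>y. (y, m y)) has_derivative (\<lambda>h. (h, m' * h))) (at y)"
    using m by (intro has_derivative_Pair has_derivative_ident) (simp add: has_field_derivative_def)
  from has_derivative_compose[OF this H]
  have "((\<lambda>y. ?H y (m y)) has_derivative (\<lambda>h. ?D * h + ?k y (m y) * (m' * h))) (at y)"
    by simp
  then show ?thesis
    unfolding has_field_derivative_def integral_mult_right
    by (rule has_derivative_eq_rhs) (simp add: fun_eq_iff algebra_simps)
qed

lemma integral_pos_of_continuous:
  fixes f :: "real \<Rightarrow> real"
  assumes "continuous_on {a..b} f" "\<And>x. x \<in> {a..b} \<Longrightarrow> f x \<ge> 0" "c \<in> {a..b}" "f c \<noteq> 0" "a < b"
  shows "integral {a..b} f > 0"
  using integral_eq_0_iff[of a b f] integral_nonneg[OF integrable_continuous_real, of a b f] assms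
  by force

text \<open>Product-to-sum formulas give the primitive; the cases separate where a frequency
  \<open>m - n\<close> or \<open>m + n\<close> is zero and cannot be divided by.\<close>

lemma antiderivative_cos_mult_cos:
  fixes m n :: nat
  obtains S where "\<And>\<theta>. (S has_real_derivative cos (real m * \<theta>) * cos (real n * \<theta>)) (at \<theta>)"
    "S pi - S 0 = (if m \<noteq> n then 0 else if n = 0 then pi else pi / 2)"
proof (cases "m = n")
  case False
  let ?S = "\<lambda>\<theta>. sin ((real m - real n) * \<theta>) / (2 * (real m - real n)) + sin (real (m + n) * \<theta>) / (2 * real (m + n))"
  have "sin ((real m - real n) * pi) = 0"
    using sin_npi_int[of "int m - int n"] by (simp add: mult.commute)
  moreover have "sin (real (m + n) * pi) = 0" by (rule sin_npi)
  moreover have "(?S has_real_derivative cos (real m * \<theta>) * cos (real n * \<theta>)) (at \<theta>)" for \<theta>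
  proof -
    have *: "((\<lambda>\<theta>. sin (p * \<theta>) / (2 * p)) has_real_derivative cos (p * \<theta>) / 2) (at \<theta>)"
      if "p \<noteq> 0" for p :: real
      using that by (auto intro!: derivative_eq_intros)
    have "(?S has_real_derivative cos ((real m - real n) * \<theta>) / 2 + cos (real (m + n) * \<theta>) / 2) (at \<theta>)"
      using False by (intro DERIV_add *) auto
    then show ?thesis
      by (simp add: cos_times_cos left_diff_distrib distrib_right add_divide_distrib)
  qed
  ultimately show ?thesis using False by (intro that[of ?S]) auto
next
  case True
  show ?thesis
  proof (cases "n = 0")
    case 0: True
    show ?thesis using True 0 by (intro that[of "\<lambda>x. x"]) auto
  next
    case False
    let ?S = "\<lambda>\<theta>. \<theta> / 2 + sin (2 * real n * \<theta>) / (4 * real n)"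
    have "sin (2 * real n * pi) = 0" using sin_npi[of "2 * n"] by simp
    moreover have "(?S has_real_derivative cos (real n * \<theta>) * cos (real n * \<theta>)) (at \<theta>)" for \<theta>
    proof -
      have "(?S has_real_derivative 1 / 2 + cos (2 * real n * \<theta>) / 2) (at \<theta>)"
        using False by (auto intro!: derivative_eq_intros simp: field_simps)
      then show ?thesis
        by (simp add: cos_times_cos add_divide_distrib mult_ac)
    qed
    ultimately show ?thesis using True False by (intro that[of ?S]) auto
  qed
qed

text \<open>The substitution is carried out on primitives: \<open>- S (arccos (f t - c))\<close> is
  continuous on the closed interval and differentiable inside. The fundamental theorem thus gives
  integrability as well, despite the singular weight at the ends.\<close>

lemma chebyshev_orthogonality_substitution:
  fixes f f' :: "real \<Rightarrow> real"
  assumes "a \<le> b" "f a = c - 1" "f b = c + 1" "continuous_on {a..b} f"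
    and der: "\<And>t. t \<in> {a<..<b} \<Longrightarrow> (f has_real_derivative f' t) (at t)"
    and bd: "\<And>t. t \<in> {a<..<b} \<Longrightarrow> c - 1 < f t \<and> f t < c + 1"
  shows "((\<lambda>t. poly (chebyshev_T m) (f t - c) * poly (chebyshev_T n) (f t - c) *
            (f' t / sqrt (1 - (f t - c)\<^sup>2)))
          has_integral (if m \<noteq> n then 0 else if n = 0 then pi else pi / 2)) {a..b}"
proof -
  obtain S where S: "\<And>\<theta>. (S has_real_derivative cos (real m * \<theta>) * cos (real n * \<theta>)) (at \<theta>)"
    "S pi - S 0 = (if m \<noteq> n then 0 else if n = 0 then pi else pi / 2)"
    using antiderivative_cos_mult_cos by blast
  let ?F = "\<lambda>t. - S (arccos (f t - c))"
  have Sc: "continuous_on A S" for A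
    using S(1) by (meson DERIV_isCont continuous_at_imp_continuous_on)
  have "((\<lambda>t. poly (chebyshev_T m) (f t - c) * poly (chebyshev_T n) (f t - c) *
            (f' t / sqrt (1 - (f t - c)\<^sup>2))) has_integral (?F b - ?F a)) {a..b}"
  proof (rule fundamental_theorem_of_calculus_interior[OF \<open>a \<le> b\<close>])
    have "- 1 \<le> f t - c \<and> f t - c \<le> 1" if "t \<in> {a..b}" for t
      using that bd[of t] assms(2,3) by (cases "t = a"; cases "t = b") auto
    then show "continuous_on {a..b} ?F"
      using assms(4) by (intro continuous_intros continuous_on_compose2[OF Sc[of UNIV]]) auto
    fix t assume t: "t \<in> {a<..<b}"
    then have u: "- 1 < f t - c" "f t - c < 1" using bd[of t] by auto
    have "((\<lambda>t. arccos (f t - c)) has_real_derivative inverse (- sqrt (1 - (f t - c)\<^sup>2)) * f' t) (at t)"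
      by (rule DERIV_chain2[where f = arccos and g = "\<lambda>t. f t - c", OF DERIV_arccos[OF u]]) (auto intro!: derivative_eq_intros der t)
    from DERIV_minus[OF DERIV_chain2[where f = S and g = "\<lambda>t. arccos (f t - c)", OF S(1) this]]
    have "(?F has_real_derivative cos (real m * arccos (f t - c)) * cos (real n * arccos (f t - c)) *
        (f' t / sqrt (1 - (f t - c)\<^sup>2))) (at t)"
      by (simp add: divide_inverse mult_ac)
    also have "cos (real m * arccos (f t - c)) = poly (chebyshev_T m) (f t - c)"
      using chebyshev_T_cos[of m "arccos (f t - c)"] u by simp
    also have "cos (real n * arccos (f t - c)) = poly (chebyshev_T n) (f t - c)"
      using chebyshev_T_cos[of n "arccos (f t - c)"] u by simp
    finally show "(?F has_vector_derivative poly (chebyshev_T m) (f t - c) * poly (chebyshev_T n) (f t - c) *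
            (f' t / sqrt (1 - (f t - c)\<^sup>2))) (at t)"
      by (simp add: has_real_derivative_iff_has_vector_derivative)
  qed
  \<comment> \<open>\<open>arccos\<close> reverses orientation: \<open>a\<close> goes to
    \<open>pi\<close> and \<open>b\<close> to 0, which the minus sign in \<open>?F\<close>
    compensates.\<close>
  moreover have "?F b - ?F a = S pi - S 0"
    using assms(2,3) by simp
  ultimately show ?thesis using S(2) by simp
qed

subsection \<open>Regularity of the ladder\<close>

text \<open>The weight may vanish at \<open>a\<close>, as \<open>t * exp (- (2 / y) * t)\<close>
  does at 0; a nonzero value of \<open>hardy_Z\<close> is therefore sought in the right half of the
  interval.\<close>

lemma integral_hardy_Z_weight_pos:
  fixes g :: "real \<Rightarrow> real"
  assumes "a < b" "continuous_on {a..b} g" "\<And>t. t \<in> {a..b} \<Longrightarrow> g t \<ge> 0"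
    "\<And>t. a < t \<Longrightarrow> t \<le> b \<Longrightarrow> g t > 0"
  shows "integral {a..b} (\<lambda>t. g t * (hardy_Z t)\<^sup>2) > 0"
proof -
  obtain c where c: "(a + b) / 2 \<le> c" "c \<le> b" "hardy_Z c \<noteq> 0"
    using hardy_Z_nonzero_on_interval[of "(a + b) / 2" b] \<open>a < b\<close> by auto
  have "g c > 0" using c \<open>a < b\<close> by (intro assms(4)) auto
  show ?thesis
  proof (rule integral_pos_of_continuous)
    show "continuous_on {a..b} (\<lambda>t. g t * (hardy_Z t)\<^sup>2)"
      by (intro continuous_intros assms continuous_on_hardy_Z)
    show "c \<in> {a..b}" using c \<open>a < b\<close> by auto
    show "g c * (hardy_Z c)\<^sup>2 \<noteq> 0" using c \<open>g c > 0\<close> by simp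
  qed (use assms in auto)
qed

definition hardy_moment :: "real \<Rightarrow> real" where
  "hardy_moment T = integral {0..T} (\<lambda>t. (hardy_Z t)\<^sup>2)"

lemma hardy_moment_strict_mono:
  assumes "0 \<le> s" "s < t"
  shows "hardy_moment s < hardy_moment t"
proof -
  have "hardy_moment s + integral {s..t} (\<lambda>t. (hardy_Z t)\<^sup>2) = hardy_moment t"
    unfolding hardy_moment_def
    by (rule Henstock_Kurzweil_Integration.integral_combine)
       (use assms in \<open>auto intro!: integrable_continuous_real continuous_intros continuous_on_hardy_Z\<close>)
  with integral_hardy_Z_weight_pos[of s t "\<lambda>_. 1"] assms show ?thesis by simp
qed

lemma hardy_moment_has_derivative:
  assumes "T > 0"
  shows "(hardy_moment has_real_derivative (hardy_Z T)\<^sup>2) (at T)"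
proof -
  have "(hardy_moment has_real_derivative (hardy_Z T)\<^sup>2) (at T within {0..T+1})"
    unfolding hardy_moment_def using assms
    by (intro integral_has_real_derivative continuous_intros continuous_on_hardy_Z) auto
  then show ?thesis using assms at_within_Icc_at[of 0 T "T+1"] by simp
qed

section \<open>The map \<open>Phi\<close> and its derivative\<close>

locale hardy_ladder =
  fixes \<mu> \<phi> :: "real \<Rightarrow> real" and y0 T1 :: real
  assumes gen: "ladder_generator y0 \<mu>" and lad: "jacobs_ladder y0 \<mu> T1 \<phi>"
begin

definition Phi :: "real \<Rightarrow> real" where
  "Phi y = integral {0..\<mu> y} (\<lambda>t. (hardy_Z t)\<^sup>2 * exp (- (2 / y) * t))"

definition Phi' :: "real \<Rightarrow> real" where
  "Phi' y = (2 / y\<^sup>2) * integral {0..\<mu> y} (\<lambda>t. t * (hardy_Z t)\<^sup>2 * exp (- (2 / y) * t)) +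
      (hardy_Z (\<mu> y))\<^sup>2 * exp (- (2 / y) * \<mu> y) * deriv \<mu> y"

lemma y0_pos: "y0 > 0"
  using gen by (simp add: ladder_generator_def)

lemma mu_mono: "y0 \<le> y \<Longrightarrow> y \<le> y' \<Longrightarrow> \<mu> y \<le> \<mu> y'"
  using gen by (auto simp: ladder_generator_def intro: mono_onD)

text \<open>Beyond \<open>y0\<close> the one-sided derivatives are two-sided, so
  \<open>deriv \<mu>\<close> is \<open>D 1\<close>, which is continuous because it is
  differentiable.\<close>

lemma mu_deriv:
  assumes "y > y0"
  shows "(\<mu> has_real_derivative deriv \<mu> y) (at y)" "deriv \<mu> y \<ge> 0" "isCont (deriv \<mu>) y"
proof -
  from gen have "smooth_on_halfline y0 \<mu>" by (simp add: ladder_generator_def)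
  then obtain D where "\<forall>y\<ge>y0. D 0 y = \<mu> y"
    "\<forall>k. \<forall>y\<ge>y0. (D k has_real_derivative D (Suc k) y) (at y within {y0..})"
    unfolding smooth_on_halfline_def by (elim exE conjE)
  then have D: "\<And>y. y \<ge> y0 \<Longrightarrow> D 0 y = \<mu> y"
    "\<And>k y. y \<ge> y0 \<Longrightarrow> (D k has_real_derivative D (Suc k) y) (at y within {y0..})"
    by blast+
  have D': "(D k has_real_derivative D (Suc k) z) (at z)" if "z > y0" for k z
    using D(2)[of z k] at_within_interior[of z "{y0..}"] that by simp
  have d: "(\<mu> has_real_derivative D 1 z) (at z)" if "z > y0" for z
    using D'[OF that, of 0] D(1) that
    by (intro has_field_derivative_transform_within_open[of "D 0" _ z "{y0<..}" \<mu>]) auto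
  have eq: "deriv \<mu> z = D 1 z" if "z > y0" for z
    using d[OF that] by (rule DERIV_imp_deriv)
  show mu: "(\<mu> has_real_derivative deriv \<mu> y) (at y)"
    using d eq assms by simp
  show "deriv \<mu> y \<ge> 0"
    using gen assms by (intro mono_on_imp_deriv_nonneg[OF _ mu, of "{y0..}"]) (auto simp: ladder_generator_def)
  have "(deriv \<mu> has_real_derivative D (Suc 1) y) (at y)"
    using D'[OF assms, of 1] eq assms
    by (intro has_field_derivative_transform_within_open[of "D 1" _ y "{y0<..}" "deriv \<mu>"]) auto
  then show "isCont (deriv \<mu>) y" by (rule DERIV_isCont)
qed

text \<open>Strictness comes from the kernel, which for \<open>t > 0\<close> grows strictly with
  \<open>y\<close>; the upper limit, being only weakly monotone, contributes a nonnegative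
  amount.\<close>

lemma Phi_strict_mono:
  assumes "y0 \<le> y" "y < y'" "\<mu> y > 0"
  shows "Phi y < Phi y'"
proof -
  have pos: "y > 0" "y' > 0" using y0_pos assms by auto
  have int: "(\<lambda>t. (hardy_Z t)\<^sup>2 * exp (- (2 / z) * t)) integrable_on {a..b}" for a b z
    by (intro integrable_continuous_real continuous_intros continuous_on_hardy_Z)
  have lt: "exp (- (2 / y) * t) < exp (- (2 / y') * t)" if "t > 0" for t
    using that pos \<open>y < y'\<close> by (simp add: field_simps)
  have "0 < integral {0..\<mu> y} (\<lambda>t. (exp (- (2 / y') * t) - exp (- (2 / y) * t)) * (hardy_Z t)\<^sup>2)"
  proof (rule integral_hardy_Z_weight_pos)
    show "exp (- (2 / y') * t) - exp (- (2 / y) * t) \<ge> 0" if "t \<in> {0..\<mu> y}" for t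
      using lt[of t] that by (cases "t = 0") auto
  qed (use lt assms pos in \<open>auto intro!: continuous_intros\<close>)
  also have "\<dots> = integral {0..\<mu> y} (\<lambda>t. (hardy_Z t)\<^sup>2 * exp (- (2 / y') * t)) - Phi y"
    unfolding Phi_def by (subst integral_diff[OF int int, symmetric]) (simp add: algebra_simps)
  finally have "Phi y < integral {0..\<mu> y} (\<lambda>t. (hardy_Z t)\<^sup>2 * exp (- (2 / y') * t))" by simp
  also have "\<dots> \<le> Phi y'"
    unfolding Phi_def using mu_mono[of y y'] assms by (intro integral_subset_le int) auto
  finally show ?thesis .
qed

text \<open>The bound \<open>7 * y * ln y\<close> is negative for \<open>y < 1\<close>, so this case
  can occur near a small \<open>y0\<close>.\<close>

lemma Phi_nonpos: "\<mu> y \<le> 0 \<Longrightarrow> Phi y = 0"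
  unfolding Phi_def by (cases "\<mu> y = 0") auto

text \<open>This forces the ladder to be unbounded without any lower bound for the growth of the
  second moment of \<open>hardy_Z\<close>.\<close>

lemma Phi_less_hardy_moment:
  assumes "y0 \<le> y" "\<mu> y > 0"
  shows "Phi y < hardy_moment (\<mu> y)"
proof -
  have pos: "y > 0" using y0_pos assms by auto
  have "0 < integral {0..\<mu> y} (\<lambda>t. (1 - exp (- (2 / y) * t)) * (hardy_Z t)\<^sup>2)"
    using pos assms by (intro integral_hardy_Z_weight_pos continuous_intros) auto
  also have "\<dots> = hardy_moment (\<mu> y) - Phi y"
    unfolding Phi_def hardy_moment_def using pos
    by (subst integral_diff[symmetric])
       (auto intro!: integrable_continuous_real continuous_intros continuous_on_hardy_Z simp: algebra_simps)
  finally show ?thesis by simp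
qed

lemma Phi_has_derivative:
  assumes "y > y0" "\<mu> y > 0"
  shows "(Phi has_real_derivative Phi' y) (at y)"
  unfolding Phi_def Phi'_def
  by (rule has_real_derivative_exp_integral_diagonal)
     (use assms y0_pos mu_deriv in \<open>auto intro!: continuous_intros continuous_on_hardy_Z\<close>)

lemma isCont_Phi':
  assumes "y > y0" "\<mu> y > 0"
  shows "isCont Phi' y"
proof -
  \<comment> \<open>The differentiation lemma again, now with \<open>t * (hardy_Z t)\<^sup>2\<close>
    as \<open>W\<close>.\<close>
  have "isCont (\<lambda>y. integral {0..\<mu> y} (\<lambda>t. t * (hardy_Z t)\<^sup>2 * exp (- (2 / y) * t))) y"
    by (rule DERIV_isCont, rule has_real_derivative_exp_integral_diagonal)
       (use assms y0_pos mu_deriv in \<open>auto intro!: continuous_intros continuous_on_hardy_Z\<close>)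
  moreover have mu: "isCont \<mu> y" using mu_deriv(1)[OF assms(1)] by (rule DERIV_isCont)
  moreover have "isCont (\<lambda>y. hardy_Z (\<mu> y)) y"
    using continuous_on_hardy_Z[of UNIV] by (intro isCont_o2[OF mu]) (simp add: continuous_on_eq_continuous_at)
  ultimately show ?thesis
    unfolding Phi'_def using assms y0_pos by (intro continuous_intros mu_deriv(3)) auto
qed

text \<open>The boundary term can vanish, at a zero of \<open>hardy_Z\<close> or where
  \<open>deriv \<mu>\<close> is 0; the kernel term alone is positive.\<close>

lemma Phi'_pos:
  assumes "y > y0" "\<mu> y > 0"
  shows "Phi' y > 0"
proof -
  have "0 < integral {0..\<mu> y} (\<lambda>t. t * exp (- (2 / y) * t) * (hardy_Z t)\<^sup>2)"
    using assms by (intro integral_hardy_Z_weight_pos continuous_intros) auto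
  then have "0 < (2 / y\<^sup>2) * integral {0..\<mu> y} (\<lambda>t. t * (hardy_Z t)\<^sup>2 * exp (- (2 / y) * t))"
    using assms y0_pos by (intro mult_pos_pos) (auto simp: mult_ac)
  moreover have "0 \<le> (hardy_Z (\<mu> y))\<^sup>2 * exp (- (2 / y) * \<mu> y) * deriv \<mu> y"
    using mu_deriv(2)[OF assms(1)] by simp
  ultimately show ?thesis unfolding Phi'_def by linarith
qed

section \<open>The ladder as the inverse of \<open>Phi\<close> composed with the second
  moment\<close>

text \<open>Beyond \<open>T1\<close> the integral equation holds, and beyond 0 the second moment is
  positive.\<close>

definition start :: real where "start = max 0 T1 + 1"

text \<open>The positive moment excludes the degenerate case of \<open>Phi_nonpos\<close>, so the
  ladder stays where \<open>Phi\<close> is strictly increasing.\<close>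

lemma phi_start:
  assumes "T \<ge> start"
  shows "T > 0" "\<phi> T \<ge> y0" "Phi (\<phi> T) = hardy_moment T" "\<mu> (\<phi> T) > 0"
proof -
  show "T > 0" using assms by (simp add: start_def)
  show "\<phi> T \<ge> y0" and eq: "Phi (\<phi> T) = hardy_moment T"
    using lad assms by (auto simp: jacobs_ladder_def Phi_def hardy_moment_def start_def)
  have "hardy_moment T > 0"
    using hardy_moment_strict_mono[of 0 T] \<open>T > 0\<close> by (simp add: hardy_moment_def)
  then show "\<mu> (\<phi> T) > 0"
    using eq Phi_nonpos[of "\<phi> T"] by fastforce
qed

lemma phi_strict_mono:
  assumes "start \<le> s" "s < t"
  shows "\<phi> s < \<phi> t"
proof (rule ccontr)
  assume "\<not> \<phi> s < \<phi> t"
  then have "Phi (\<phi> t) \<le> Phi (\<phi> s)"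
    using Phi_strict_mono[of "\<phi> t" "\<phi> s"] phi_start[of t] assms by (cases "\<phi> t = \<phi> s") auto
  moreover have "hardy_moment s < hardy_moment t"
    using assms phi_start(1)[of s] by (intro hardy_moment_strict_mono) auto
  ultimately show False using phi_start(3)[of s] phi_start(3)[of t] assms by simp
qed

lemma above_start:
  assumes "y \<ge> \<phi> start"
  shows "y \<ge> y0" "\<mu> y > 0"
  using phi_start[OF order.refl] mu_mono[of "\<phi> start" y] assms by auto

text \<open>The intermediate value theorem for \<open>hardy_moment\<close> on
  \<open>[start, \<mu> y]\<close> yields \<open>T\<close> with
  \<open>hardy_moment T = Phi y\<close>; injectivity of \<open>Phi\<close> then identifies
  \<open>\<phi> T\<close> with \<open>y\<close>.\<close>

lemma phi_surj:
  assumes "y \<ge> \<phi> start"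
  obtains T where "T \<ge> start" "\<phi> T = y"
proof -
  note y = above_start[OF assms]
  have "hardy_moment start = Phi (\<phi> start)" by (simp add: phi_start(3))
  also have "\<dots> \<le> Phi y"
    using Phi_strict_mono[of "\<phi> start" y] assms phi_start[OF order.refl] by (cases "y = \<phi> start") auto
  finally have lo: "hardy_moment start \<le> Phi y" .
  have hi: "Phi y < hardy_moment (\<mu> y)" using Phi_less_hardy_moment y by simp
  \<comment> \<open>Otherwise
    \<open>hardy_moment (\<mu> y) < hardy_moment start \<le> Phi y\<close>, against
    \<open>hi\<close>.\<close>
  have "start \<le> \<mu> y"
    using hardy_moment_strict_mono[of "\<mu> y" start] y lo hi by linarith
  moreover have "isCont hardy_moment x" if "start \<le> x" for x
    using hardy_moment_has_derivative[OF phi_start(1)[OF that]] by (rule DERIV_isCont)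
  ultimately obtain T where T: "start \<le> T" "hardy_moment T = Phi y"
    using IVT[of hardy_moment start "Phi y" "\<mu> y"] lo hi by auto
  then have "Phi (\<phi> T) = Phi y" by (simp add: phi_start(3))
  then have "\<phi> T = y"
    using Phi_strict_mono[of "\<phi> T" y] Phi_strict_mono[of y "\<phi> T"] phi_start[OF T(1)] y
    by (cases "\<phi> T" y rule: linorder_cases) auto
  with T show ?thesis by (intro that)
qed

text \<open>The integral equation gives no direct continuity of \<open>\<phi>\<close>. The inverse
  function theorem is therefore applied to \<open>Phi\<close> on an open half-line, and
  \<open>\<phi>\<close> is recognised there as \<open>g\<close> after
  \<open>hardy_moment\<close>.\<close>

lemma phi_has_derivative:
  assumes "T > start"
  shows "(\<phi> has_real_derivative (hardy_Z T)\<^sup>2 / Phi' (\<phi> T)) (at T)"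
proof -
  let ?S = "{\<phi> start<..}"
  define g where "g = inv_into ?S Phi"
  have S: "y > y0" "\<mu> y > 0" if "y \<in> ?S" for y
    using that above_start[of y] phi_start(2)[OF order.refl] by auto
  have phiS: "\<phi> t \<in> ?S" if "t > start" for t
    using phi_strict_mono[OF order.refl that] by simp
  have inj: "inj_on Phi ?S"
  proof (rule inj_onI)
    fix x y assume "x \<in> ?S" "y \<in> ?S" "Phi x = Phi y"
    then show "x = y"
      using Phi_strict_mono[of x y] Phi_strict_mono[of y x] S[of x] S[of y]
      by (cases x y rule: linorder_cases) auto
  qed
  have g: "g (Phi y) = y" if "y \<in> ?S" for y
    unfolding g_def using inj that by (rule inv_into_f_f)
  have "(g has_real_derivative inverse (Phi' (\<phi> T))) (at (Phi (\<phi> T)))"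
  proof (rule has_field_derivative_inverse_strong[where S = ?S and f = Phi and x = "\<phi> T"])
    show "(Phi has_real_derivative Phi' (\<phi> T)) (at (\<phi> T))"
      using S phiS[OF assms] by (intro Phi_has_derivative) auto
    show "Phi' (\<phi> T) \<noteq> 0" using Phi'_pos S phiS[OF assms] by (metis less_irrefl)
    show "continuous_on ?S Phi"
      using S Phi_has_derivative by (meson DERIV_isCont continuous_at_imp_continuous_on)
  qed (use phiS[OF assms] g in auto)
  then have "(g has_real_derivative inverse (Phi' (\<phi> T))) (at (hardy_moment T))"
    using phi_start(3)[of T] assms by simp
  from DERIV_chain2[OF this hardy_moment_has_derivative]
  have "((\<lambda>t. g (hardy_moment t)) has_real_derivative (hardy_Z T)\<^sup>2 / Phi' (\<phi> T)) (at T)"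
    using phi_start(1)[of T] assms by (simp add: divide_inverse mult.commute)
  then show ?thesis
    by (rule has_field_derivative_transform_within_open[of _ _ T "{start<..}"])
       (use assms g phiS phi_start(3) in \<open>auto simp flip: phi_start(3)\<close>)
qed

text \<open>The derivative formula holds strictly beyond \<open>start\<close>; beginning at
  \<open>start + 1\<close> makes the function differentiable at the left endpoint too.\<close>

lemma ladder_regular: "ladder_regular_from (start + 1) (\<lambda>t. \<phi> t / 2)"
proof -
  let ?f = "\<lambda>t. \<phi> t / 2"
  have der: "(?f has_real_derivative (hardy_Z t)\<^sup>2 / Phi' (\<phi> t) / 2) (at t)" if "t > start" for t
    by (intro DERIV_cdivide phi_has_derivative that)
  have S: "\<phi> t > y0" "\<mu> (\<phi> t) > 0" if "t > start" for t
    using phi_strict_mono[OF order.refl that] phi_start(2)[OF order.refl] phi_start(4)[of t] that by auto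
  have "continuous_on {start+1..} (\<lambda>t. (hardy_Z t)\<^sup>2 / Phi' (\<phi> t) / 2)"
  proof (intro continuous_intros continuous_on_hardy_Z)
    have "isCont (\<lambda>t. Phi' (\<phi> t)) t" if "t > start" for t
      by (rule isCont_o2[OF DERIV_isCont[OF phi_has_derivative[OF that]] isCont_Phi'[OF S[OF that]]])
    then show "continuous_on {start+1..} (\<lambda>t. Phi' (\<phi> t))"
      by (intro continuous_at_imp_continuous_on) auto
    show "\<forall>t\<in>{start+1..}. Phi' (\<phi> t) \<noteq> 0"
      using Phi'_pos[OF S] by (metis add.commute atLeast_iff less_add_one less_irrefl order_less_le_trans)
  qed auto
  then have "continuous_on {start+1..} (deriv ?f)"
    by (rule continuous_on_eq) (rule DERIV_imp_deriv[OF der, symmetric], auto)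
  moreover have "?f differentiable (at t)" if "t \<ge> start + 1" for t
    using der[of t] that by (simp add: real_differentiable_def exI[of _ "(hardy_Z t)\<^sup>2 / Phi' (\<phi> t) / 2"])
  moreover have sm: "strict_mono_on {start+1..} ?f"
    by (auto intro!: strict_mono_onI phi_strict_mono)
  moreover have "bij_betw ?f {start+1..} {?f (start+1)..}"
  proof (rule bij_betw_imageI)
    show "inj_on ?f {start+1..}" using sm by (rule strict_mono_on_imp_inj_on)
    show "?f ` {start+1..} = {?f (start+1)..}"
    proof (intro equalityI subsetI)
      fix y assume "y \<in> ?f ` {start+1..}"
      then obtain t where t: "y = ?f t" "t \<ge> start + 1" by auto
      then show "y \<in> {?f (start+1)..}"
        using phi_strict_mono[of "start + 1" t] by (cases "t = start + 1") auto
    next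
      fix y assume y: "y \<in> {?f (start+1)..}"
      then have "2 * y \<ge> \<phi> start" using phi_strict_mono[of start "start + 1"] by simp
      then obtain T where T: "T \<ge> start" "\<phi> T = 2 * y" by (rule phi_surj)
      \<comment> \<open>\<open>phi_surj\<close> only places \<open>T\<close> beyond
        \<open>start\<close>; a \<open>T\<close> below \<open>start + 1\<close> would have too small
        a value.\<close>
      then have "T \<ge> start + 1" using y phi_strict_mono[of T "start + 1"] by force
      with T show "y \<in> ?f ` {start+1..}" by (auto intro!: image_eqI[of _ _ T])
    qed
  qed
  ultimately show ?thesis unfolding ladder_regular_from_def by blast
qed

end

section \<open>Chebyshev orthogonality along the ladder\<close>

text \<open>Between the two preimages \<open>f\<close> climbs from \<open>T\<close> to
  \<open>T + 2\<close>, so the substitution lemma applies with centre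
  \<open>c = T + 1\<close>.\<close>

lemma ladder_regular_chebyshev_has_integral:
  fixes f :: "real \<Rightarrow> real"
  assumes reg: "ladder_regular_from t0 f" and T: "T \<ge> f t0"
  shows "((\<lambda>t. poly (chebyshev_T m) (f t - T - 1) * poly (chebyshev_T n) (f t - T - 1) *
            (deriv f t / sqrt (1 - (f t - T - 1)\<^sup>2)))
          has_integral (if m \<noteq> n then 0 else if n = 0 then pi else pi / 2))
          {inv_into {t0..} f T..inv_into {t0..} f (T + 2)}"
proof -
  define a b where "a = inv_into {t0..} f T" and "b = inv_into {t0..} f (T + 2)"
  have "bij_betw f {t0..} {f t0..}" using reg by (simp add: ladder_regular_from_def)
  then have im: "f ` {t0..} = {f t0..}" by (rule bij_betw_imp_surj_on)
  have a: "a \<ge> t0" "f a = T"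
    using inv_into_into[of T f "{t0..}"] f_inv_into_f[of T f "{t0..}"] T im by (auto simp: a_def)
  have b: "b \<ge> t0" "f b = T + 2"
    using inv_into_into[of "T + 2" f "{t0..}"] f_inv_into_f[of "T + 2" f "{t0..}"] T im
    by (auto simp: b_def)
  have sm: "f s < f t" if "t0 \<le> s" "s < t" for s t
    using reg that by (auto simp: ladder_regular_from_def strict_mono_on_def)
  have "a \<le> b" using sm[of b a] a b by force
  have der: "(f has_real_derivative deriv f t) (at t)" if "t \<ge> t0" for t
    using reg that by (simp add: ladder_regular_from_def DERIV_deriv_iff_real_differentiable)
  have "((\<lambda>t. poly (chebyshev_T m) (f t - (T + 1)) * poly (chebyshev_T n) (f t - (T + 1)) *
            (deriv f t / sqrt (1 - (f t - (T + 1))\<^sup>2)))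
          has_integral (if m \<noteq> n then 0 else if n = 0 then pi else pi / 2)) {a..b}"
  proof (rule chebyshev_orthogonality_substitution[OF \<open>a \<le> b\<close>])
    show "continuous_on {a..b} f"
      using a(1) by (intro continuous_at_imp_continuous_on ballI DERIV_isCont[OF der]) auto
    show "T + 1 - 1 < f t \<and> f t < T + 1 + 1" if "t \<in> {a<..<b}" for t
      using sm[of a t] sm[of t b] a b that by auto
  qed (use a b der in auto)
  then show ?thesis by (simp add: a_def b_def diff_diff_eq)
qed

theorem corollary4:
  fixes \<mu> \<phi> \<phi>1 :: "real \<Rightarrow> real" and y0 T1 :: real
  assumes "ladder_generator y0 \<mu>"
    and "jacobs_ladder y0 \<mu> T1 \<phi>"
    and "\<phi>1 = (\<lambda>t. \<phi> t / 2)"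
  shows "\<exists>t0>T1. ladder_regular_from t0 \<phi>1 \<and>
    (\<exists>T0\<ge>\<phi>1 t0. \<forall>T\<ge>T0.
      let a = inv_into {t0..} \<phi>1 T;
          b = inv_into {t0..} \<phi>1 (T + 2);
          w = (\<lambda>t. deriv \<phi>1 t / sqrt (1 - (\<phi>1 t - T - 1)\<^sup>2))
      in
        (\<forall>m n. m \<noteq> n \<longrightarrow>
          ((\<lambda>t. poly (chebyshev_T m) (\<phi>1 t - T - 1) * poly (chebyshev_T n) (\<phi>1 t - T - 1) * w t)
             has_integral 0) {a..b}) \<and>
        (\<forall>n. ((\<lambda>t. (poly (chebyshev_T n) (\<phi>1 t - T - 1))\<^sup>2 * w t)
             has_integral (if n = 0 then pi else pi / 2)) {a..b}))"
proof -
  interpret hardy_ladder \<mu> \<phi> y0 T1 using assms by unfold_locales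
  have reg: "ladder_regular_from (start + 1) \<phi>1" using ladder_regular assms(3) by simp
  have "start + 1 > T1" by (simp add: start_def)
  moreover note reg
  \<comment> \<open>The witness for \<open>T0\<close> is \<open>\<phi>1 (start + 1)\<close>, the
    least value with a preimage in \<open>{start + 1..}\<close>.\<close>
  moreover have "\<forall>T\<ge>\<phi>1 (start + 1).
      let a = inv_into {start + 1..} \<phi>1 T;
          b = inv_into {start + 1..} \<phi>1 (T + 2);
          w = (\<lambda>t. deriv \<phi>1 t / sqrt (1 - (\<phi>1 t - T - 1)\<^sup>2))
      in
        (\<forall>m n. m \<noteq> n \<longrightarrow>
          ((\<lambda>t. poly (chebyshev_T m) (\<phi>1 t - T - 1) * poly (chebyshev_T n) (\<phi>1 t - T - 1) * w t)
             has_integral 0) {a..b}) \<and>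
        (\<forall>n. ((\<lambda>t. (poly (chebyshev_T n) (\<phi>1 t - T - 1))\<^sup>2 * w t)
             has_integral (if n = 0 then pi else pi / 2)) {a..b})"
    \<comment> \<open>Only the square of the polynomial is expanded, so that the norm formula
      becomes the case \<open>m = n\<close> of the preceding lemma.\<close>
    unfolding Let_def power2_eq_square[of "poly _ _"]
  proof (intro allI impI conjI, goal_cases)
    case (1 T m n)
    then show ?case using ladder_regular_chebyshev_has_integral[OF reg, of T m n] by simp
  next
    case (2 T n)
    then show ?case using ladder_regular_chebyshev_has_integral[OF reg, of T n n] by simp
  qed
  ultimately show ?thesis by blast
qed

end
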